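(* Let $\boldsymbol{\varkappa}=(\varkappa_j)_{j\in\mathbb{N}}\in\ell_1(\mathbb{N})$ be a fixed sequence with $\varkappa_j>\varkappa_{j+1}>0$ for all $j\in\mathbb{N}$. Let $\Lambda(\boldsymbol{\varkappa})$ be the set of all real sequences $\boldsymbol{\lambda}=(\lambda_j)_{j\in\mathbb{N}}$ such that $\varkappa_j>|\lambda_j|>\varkappa_{j+1}$ for all $j\in\mathbb{N}$, and for $\boldsymbol{\lambda}\in\Lambda(\boldsymbol{\varkappa})$ set $$g_{\boldsymbol{\lambda}}(z):=\prod_{j=1}^\infty\frac{z-\lambda_j}{z+\lambda_j}.$$ Then $\boldsymbol{\lambda}\in\Lambda(\boldsymbol{\varkappa})$ is uniquely determined by the values of $g_{\boldsymbol{\lambda}}$ at the points $\varkappa_j$, $j\in\mathbb{N}$; that is, if $\boldsymbol{\lambda},\tilde{\boldsymbol{\lambda}}\in\Lambda(\boldsymbol{\varkappa})$ satisfy $g_{\boldsymbol{\lambda}}(\varkappa_j)=g_{\tilde{\boldsymbol{\lambda}}}(\varkappa_j)$ for all $j\in\mathbb{N}$, then $\boldsymbol{\lambda}=\tilde{\boldsymbol{\lambda}}$.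
   Context: The product defining $g_{\boldsymbol{\lambda}}$ converges and is holomorphic on $\mathbb{C}\setminus(\{0\}\cup\{-\lambda_j\}_{j\in\mathbb{N}})$; in particular it is defined at each $\varkappa_j$. *)

theory Defs
  imports "HOL-Analysis.Analysis"
begin

text \<open>
  Sequences indexed by the positive integers in the paper are indexed by
  \<^typ>\<open>nat\<close> here, so the first term is the one with index 0.
\<close>

definition Lambda :: "(nat \<Rightarrow> real) \<Rightarrow> (nat \<Rightarrow> real) set" where
  "Lambda \<kappa> = {l. \<forall>j. \<kappa> j > \<bar>l j\<bar> \<and> \<bar>l j\<bar> > \<kappa> (Suc j)}"

text \<open>
  The value is meaningful only for \<open>z\<close> different from 0 and from every
  \<open>- l j\<close>. Convergence in the sense of \<^const>\<open>prodinf\<close> allows finitely many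
  vanishing factors, so the zeros \<open>z = l j\<close> are covered.
\<close>

definition g :: "(nat \<Rightarrow> real) \<Rightarrow> complex \<Rightarrow> complex" where
  "g l z = (\<Prod>j. (z - complex_of_real (l j)) / (z + complex_of_real (l j)))"

end

(*
  In the variable w = 1/z, with P(w) = prod (1 - l_j w) and Q(w) = prod (1 - l'_j w), equality of the
  values at kappa_j says that the odd entire function F(w) = P(w) Q(-w) - P(-w) Q(w) vanishes at 0
  and at all +-1/kappa_j. With K(w) = prod (1 + kappa_j w), the bounds |l_j|, |l'_j| < kappa_j give
  |F| <= 2 |K|^2 on the imaginary and on the positive real axis. F has exponential type 0, so
  Phragmen-Lindelof in the two quadrants gives this bound on the right half plane. Dividing out the
  zeros by Blaschke factors improves it to |F| <= 2 |prod (1 - kappa_j^2 w^2)|, and since F has the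
  additional zero at 0 a Liouville argument yields F = 0. Then P and Q have the same zeros, because
  by interlacing the |l_j| are distinct and P(w), P(-w) have no common zero.
*)

theory Submission
  imports Defs "HOL-Complex_Analysis.Complex_Analysis"
begin

section \<open>Canonical products with absolutely summable coefficients\<close>

text \<open>The genus zero canonical product with zeros at \<open>- 1 / a j\<close>; an index with
  \<open>a j = 0\<close> contributes the factor 1. The argument plays the role of 1/z, which moves
  the accumulation point 0 of the sequences to infinity and makes the product entire.\<close>

definition canprod :: "(nat \<Rightarrow> real) \<Rightarrow> complex \<Rightarrow> complex" where
  "canprod a w = (\<Prod>j. 1 + of_real (a j) * w)"

lemma convergent_canprod:
  assumes "summable (\<lambda>j. \<bar>a j\<bar>)"
  shows "convergent_prod (\<lambda>j. 1 + of_real (a j) * w :: complex)"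
proof -
  have "summable (\<lambda>j. \<bar>a j\<bar> * cmod w)"
    using assms by (rule summable_mult2)
  then show ?thesis
    by (intro abs_convergent_prod_imp_convergent_prod summable_imp_abs_convergent_prod)
       (simp add: norm_mult)
qed

lemma canprod_LIMSEQ:
  assumes "summable (\<lambda>j. \<bar>a j\<bar>)"
  shows "(\<lambda>n. \<Prod>j<n. 1 + of_real (a j) * w) \<longlonglongrightarrow> canprod a w"
  using convergent_prod_LIMSEQ[OF convergent_canprod[OF assms]]
  by (simp add: canprod_def LIMSEQ_lessThan_iff_atMost)

text \<open>Convergence of an infinite product excludes a zero limit of nonzero factors, so all
  zeros can be read off the coefficients.\<close>

lemma canprod_eq_0_iff:
  assumes "summable (\<lambda>j. \<bar>a j\<bar>)"
  shows "canprod a w = 0 \<longleftrightarrow> (\<exists>j. 1 + of_real (a j) * w = 0)"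
  using has_prod_eq_0_iff[OF convergent_prod_has_prod[OF convergent_canprod[OF assms]]]
  unfolding canprod_def image_iff by (metis UNIV_I)

lemma canprod_uminus: "canprod (\<lambda>j. - a j) w = canprod a (- w)"
  by (simp add: canprod_def)

text \<open>Separates finitely many factors, polynomial in \<open>w\<close>, from a tail whose
  coefficient sum is small for large \<open>m\<close>.\<close>

lemma canprod_split:
  assumes "summable (\<lambda>j. \<bar>a j\<bar>)"
  shows "canprod a w = (\<Prod>j<m. 1 + of_real (a j) * w) * canprod (\<lambda>j. a (j + m)) w"
proof (rule LIMSEQ_unique)
  have "summable (\<lambda>j. \<bar>a (j + m)\<bar>)"
    using summable_ignore_initial_segment[OF assms, of m] by simp
  from tendsto_mult_left[OF canprod_LIMSEQ[OF this, of w]]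
  show "(\<lambda>n. (\<Prod>j<m. 1 + of_real (a j) * w) * (\<Prod>j<n. 1 + of_real (a (j + m)) * w))
      \<longlonglongrightarrow> (\<Prod>j<m. 1 + of_real (a j) * w) * canprod (\<lambda>j. a (j + m)) w" .
  have "(\<Prod>j<m. 1 + of_real (a j) * w) * (\<Prod>j<n. 1 + of_real (a (j + m)) * w)
      = (\<Prod>j<n+m. 1 + of_real (a j) * w)" for n
    by (induction n) (simp_all add: mult_ac)
  with LIMSEQ_ignore_initial_segment[OF canprod_LIMSEQ[OF assms, of w], of m]
  show "(\<lambda>n. (\<Prod>j<m. 1 + of_real (a j) * w) * (\<Prod>j<n. 1 + of_real (a (j + m)) * w))
      \<longlonglongrightarrow> canprod a w"
    by simp
qed

text \<open>The partial products converge uniformly on every closed disc of radius 1, by the M-test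
  with majorant \<open>\<bar>a n\<bar> * ?R\<close>.\<close>

lemma holomorphic_canprod:
  assumes "summable (\<lambda>j. \<bar>a j\<bar>)"
  shows "canprod a holomorphic_on A"
proof -
  have "canprod a holomorphic_on UNIV"
  proof (rule holomorphic_uniform_sequence)
    show "(\<lambda>w. \<Prod>j<n. 1 + of_real (a j) * w) holomorphic_on UNIV" for n
      by (intro holomorphic_intros)
    fix x :: complex
    let ?R = "cmod x + 1"
    have "uniformly_convergent_on (cball x 1) (\<lambda>n w. \<Sum>j<n. norm (of_real (a j) * w :: complex))"
    proof (rule Weierstrass_m_test'_ev)
      show "\<forall>\<^sub>F n in sequentially. \<forall>w\<in>cball x 1. norm (norm (of_real (a n) * w :: complex)) \<le> \<bar>a n\<bar> * ?R"
      proof (intro always_eventually allI ballI)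
        fix n w assume "w \<in> cball x 1"
        then have "cmod w \<le> ?R"
          using norm_triangle_sub[of w x] by (simp add: dist_norm norm_minus_commute)
        then show "norm (norm (of_real (a n) * w :: complex)) \<le> \<bar>a n\<bar> * ?R"
          by (simp add: norm_mult mult_left_mono)
      qed
      show "summable (\<lambda>n. \<bar>a n\<bar> * ?R)"
        using assms by (rule summable_mult2)
    qed
    then have "uniformly_convergent_on (cball x 1) (\<lambda>n w. \<Prod>j<n. 1 + of_real (a j) * w :: complex)"
      by (intro uniformly_convergent_on_prod) (auto intro!: continuous_intros)
    then obtain h where h: "uniform_limit (cball x 1) (\<lambda>n w. \<Prod>j<n. 1 + of_real (a j) * w) h sequentially"
      by (auto simp: uniformly_convergent_on_def)
    have "h w = canprod a w" if "w \<in> cball x 1" for w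
      using tendsto_uniform_limitI[OF h that] canprod_LIMSEQ[OF assms] LIMSEQ_unique by blast
    then have "uniform_limit (cball x 1) (\<lambda>n w. \<Prod>j<n. 1 + of_real (a j) * w) (canprod a) sequentially"
      using h by (metis (no_types, lifting) uniform_limit_cong')
    then show "\<exists>d>0. cball x d \<subseteq> UNIV \<and>
        uniform_limit (cball x d) (\<lambda>n w. \<Prod>j<n. 1 + of_real (a j) * w) (canprod a) sequentially"
      by (intro exI[of _ 1]) auto
  qed simp
  then show ?thesis
    by (rule holomorphic_on_subset) simp
qed

lemma holomorphic_on_canprod [holomorphic_intros]:
  assumes "summable (\<lambda>j. \<bar>a j\<bar>)" "f holomorphic_on A"
  shows "(\<lambda>w. canprod a (f w)) holomorphic_on A"
  using holomorphic_on_compose[OF assms(2) holomorphic_canprod[OF assms(1)]] by (simp add: o_def)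

lemma norm_canprod_le:
  assumes a: "summable (\<lambda>j. \<bar>a j\<bar>)" and b: "summable (\<lambda>j. \<bar>b j\<bar>)"
    and le: "\<And>j. cmod (1 + of_real (a j) * w) \<le> cmod (1 + of_real (b j) * z)"
  shows "cmod (canprod a w) \<le> cmod (canprod b z)"
proof (rule LIMSEQ_le)
  show "(\<lambda>n. cmod (\<Prod>j<n. 1 + of_real (a j) * w)) \<longlonglongrightarrow> cmod (canprod a w)"
    by (intro tendsto_norm canprod_LIMSEQ a)
  show "(\<lambda>n. cmod (\<Prod>j<n. 1 + of_real (b j) * z)) \<longlonglongrightarrow> cmod (canprod b z)"
    by (intro tendsto_norm canprod_LIMSEQ b)
  show "\<exists>N. \<forall>n\<ge>N. cmod (\<Prod>j<n. 1 + of_real (a j) * w) \<le> cmod (\<Prod>j<n. 1 + of_real (b j) * z)"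
    unfolding prod_norm[symmetric] using le by (auto intro!: prod_mono)
qed

lemma norm_canprod_le_exp:
  assumes "summable (\<lambda>j. \<bar>a j\<bar>)"
  shows "cmod (canprod a w) \<le> exp (cmod w * (\<Sum>j. \<bar>a j\<bar>))"
proof (rule LIMSEQ_le_const2)
  show "(\<lambda>n. cmod (\<Prod>j<n. 1 + of_real (a j) * w)) \<longlonglongrightarrow> cmod (canprod a w)"
    by (intro tendsto_norm canprod_LIMSEQ assms)
  have "cmod (\<Prod>j<n. 1 + of_real (a j) * w) \<le> exp (cmod w * (\<Sum>j. \<bar>a j\<bar>))" for n
  proof -
    have "cmod (1 + of_real (a j) * w) \<le> 1 + cmod w * \<bar>a j\<bar>" for j
      using norm_triangle_ineq[of 1 "of_real (a j) * w"] by (simp add: norm_mult mult.commute)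
    then have "cmod (\<Prod>j<n. 1 + of_real (a j) * w) \<le> (\<Prod>j<n. 1 + cmod w * \<bar>a j\<bar>)"
      unfolding prod_norm[symmetric] by (intro prod_mono) auto
    also have "\<dots> \<le> exp (\<Sum>j<n. cmod w * \<bar>a j\<bar>)"
      by (rule prod_le_exp_sum) auto
    also have "\<dots> \<le> exp (cmod w * (\<Sum>j. \<bar>a j\<bar>))"
      unfolding sum_distrib_left[symmetric] exp_le_cancel_iff
      by (intro mult_left_mono sum_le_suminf assms) auto
    finally show ?thesis .
  qed
  then show "\<exists>N. \<forall>n\<ge>N. cmod (\<Prod>j<n. 1 + of_real (a j) * w) \<le> exp (cmod w * (\<Sum>j. \<bar>a j\<bar>))"
    by blast
qed

text \<open>Polynomial growth is slower than any exponential. The induction spends half of the rate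
  \<epsilon> on the new factor and leaves the other half for the earlier ones.\<close>

lemma prod_linear_le_exp:
  fixes a :: "nat \<Rightarrow> real"
  assumes "\<epsilon> > 0"
  shows "\<exists>C>0. \<forall>r\<ge>0. (\<Prod>j<m. 1 + \<bar>a j\<bar> * r) \<le> C * exp (\<epsilon> * r)"
  using assms
proof (induction m arbitrary: \<epsilon>)
  case 0
  then show ?case by (intro exI[of _ 1]) auto
next
  case (Suc m)
  from Suc.IH[of "\<epsilon>/2"] Suc.prems
  obtain C where C: "C > 0" "\<And>r. r \<ge> 0 \<Longrightarrow> (\<Prod>j<m. 1 + \<bar>a j\<bar> * r) \<le> C * exp (\<epsilon>/2 * r)"
    by auto
  \<comment> \<open>Chosen so that \<open>D \<ge> 1\<close> and
    \<open>D * (\<epsilon>/2) \<ge> \<bar>a m\<bar>\<close>, which compares the new factor with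
    \<open>D * (1 + \<epsilon>/2 * r)\<close> coefficient by coefficient.\<close>
  define D where "D = 1 + 2 * \<bar>a m\<bar> / \<epsilon>"
  have D: "D \<ge> 1" using Suc.prems by (simp add: D_def)
  have "(\<Prod>j<Suc m. 1 + \<bar>a j\<bar> * r) \<le> (C * D) * exp (\<epsilon> * r)" if r: "r \<ge> 0" for r
  proof -
    have "1 + \<bar>a m\<bar> * r \<le> D * (1 + \<epsilon>/2 * r)"
      using r Suc.prems by (simp add: D_def field_simps)
    also have "\<dots> \<le> D * exp (\<epsilon>/2 * r)"
      using D exp_ge_add_one_self[of "\<epsilon>/2 * r"] by (intro mult_left_mono) auto
    finally have "(\<Prod>j<Suc m. 1 + \<bar>a j\<bar> * r) \<le> (C * exp (\<epsilon>/2 * r)) * (D * exp (\<epsilon>/2 * r))"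
      using C r by (auto intro!: mult_mono)
    also have "\<dots> = (C * D) * (exp (\<epsilon>/2 * r) * exp (\<epsilon>/2 * r))"
      by (simp add: mult_ac)
    also have "exp (\<epsilon>/2 * r) * exp (\<epsilon>/2 * r) = exp (\<epsilon> * r)"
      by (simp add: exp_add[symmetric] field_simps)
    finally show ?thesis .
  qed
  moreover have "C * D > 0" using C(1) D by simp
  ultimately show ?case by blast
qed

lemma summable_tail_small:
  fixes a :: "nat \<Rightarrow> real"
  assumes "summable (\<lambda>j. \<bar>a j\<bar>)" "\<epsilon> > 0"
  obtains m where "(\<Sum>j. \<bar>a (j + m)\<bar>) < \<epsilon>"
proof -
  have "(\<lambda>m. \<Sum>j. \<bar>a (j + m)\<bar>) \<longlonglongrightarrow> 0"
    using suminf_exist_split2[OF assms(1)] by simp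
  then have "\<forall>\<^sub>F m in sequentially. (\<Sum>j. \<bar>a (j + m)\<bar>) < \<epsilon>"
    using assms(2) by (rule order_tendstoD)
  then show ?thesis
    using that by (auto simp: eventually_sequentially)
qed

text \<open>Exponential type 0: the tail has type below \<epsilon>/2 once its coefficient sum is
  that small, and the finitely many remaining factors are absorbed by another \<epsilon>/2.\<close>

lemma canprod_minimal_type:
  assumes a: "summable (\<lambda>j. \<bar>a j\<bar>)" and "\<epsilon> > 0"
  obtains C where "C > 0" "\<And>w. cmod (canprod a w) \<le> C * exp (\<epsilon> * cmod w)"
proof -
  obtain m where m: "(\<Sum>j. \<bar>a (j + m)\<bar>) < \<epsilon>/2"
    using summable_tail_small[OF a, of "\<epsilon>/2"] \<open>\<epsilon> > 0\<close> by auto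
  obtain C where C: "C > 0" "\<And>r. r \<ge> 0 \<Longrightarrow> (\<Prod>j<m. 1 + \<bar>a j\<bar> * r) \<le> C * exp (\<epsilon>/2 * r)"
    using prod_linear_le_exp[of "\<epsilon>/2" a m] \<open>\<epsilon> > 0\<close> by auto
  have "cmod (canprod a w) \<le> C * exp (\<epsilon> * cmod w)" for w
  proof -
    have "summable (\<lambda>j. \<bar>a (j + m)\<bar>)"
      using summable_ignore_initial_segment[OF a, of m] by simp
    from norm_canprod_le_exp[OF this, of w]
    have "cmod (canprod (\<lambda>j. a (j + m)) w) \<le> exp (cmod w * (\<Sum>j. \<bar>a (j + m)\<bar>))" .
    also have "\<dots> \<le> exp (\<epsilon>/2 * cmod w)"
      using m mult_left_mono[of "\<Sum>j. \<bar>a (j + m)\<bar>" "\<epsilon>/2" "cmod w"]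
      by (simp add: mult.commute)
    finally have 1: "cmod (canprod (\<lambda>j. a (j + m)) w) \<le> exp (\<epsilon>/2 * cmod w)" .
    have "cmod (1 + of_real (a j) * w) \<le> 1 + \<bar>a j\<bar> * cmod w" for j
      using norm_triangle_ineq[of 1 "of_real (a j) * w"] by (simp add: norm_mult)
    then have "cmod (\<Prod>j<m. 1 + of_real (a j) * w) \<le> (\<Prod>j<m. 1 + \<bar>a j\<bar> * cmod w)"
      unfolding prod_norm[symmetric] by (intro prod_mono) auto
    also have "\<dots> \<le> C * exp (\<epsilon>/2 * cmod w)"
      by (rule C) simp
    finally have "cmod (canprod a w) \<le> C * exp (\<epsilon>/2 * cmod w) * exp (\<epsilon>/2 * cmod w)"
      unfolding canprod_split[OF a, of w m] norm_mult using 1 C(1) by (intro mult_mono) auto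
    also have "\<dots> = C * exp (\<epsilon> * cmod w)"
      by (simp add: exp_add[symmetric] mult.assoc field_simps)
    finally show ?thesis .
  qed
  with C(1) show ?thesis using that by blast
qed

section \<open>Comparison of moduli in the right half plane\<close>

text \<open>Real and imaginary parts compare separately in absolute value. The sign of
  \<open>a\<close> is free, so one majorant serves the products at \<open>w\<close> and at
  \<open>- w\<close>.\<close>

lemma norm_one_plus_mult_le:
  assumes "\<bar>a\<bar> \<le> k" "Re w \<ge> 0" "Re w = 0 \<or> Im w = 0"
  shows "cmod (1 + of_real a * w) \<le> cmod (1 + of_real k * w)"
proof -
  have "\<bar>1 + a * Re w\<bar> \<le> \<bar>1 + k * Re w\<bar>"
    using assms abs_ge_self[of a] abs_ge_minus_self[of a]
      mult_right_mono[of "a" k "Re w"] mult_right_mono[of "-a" k "Re w"] by auto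
  moreover have "\<bar>a * Im w\<bar> \<le> \<bar>k * Im w\<bar>"
    unfolding abs_mult using assms by (intro mult_right_mono) auto
  ultimately have "(1 + a * Re w)\<^sup>2 + (a * Im w)\<^sup>2 \<le> (1 + k * Re w)\<^sup>2 + (k * Im w)\<^sup>2"
    by (intro add_mono) (simp_all add: abs_le_square_iff)
  then show ?thesis
    by (simp add: cmod_def)
qed

text \<open>Every factor has real part at least 1. This permits division by the product on the
  closed half plane, and the division does not increase moduli.\<close>

lemma one_le_norm_canprod:
  assumes "summable (\<lambda>j. \<bar>k j\<bar>)" "\<And>j. k j \<ge> 0" "Re w \<ge> 0"
  shows "1 \<le> cmod (canprod k w)"
proof -
  have "1 \<le> cmod (1 + of_real (k j) * w)" for j
  proof -
    have "1 \<le> Re (1 + of_real (k j) * w)" using assms by simp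
    also have "\<dots> \<le> cmod (1 + of_real (k j) * w)" by (rule complex_Re_le_cmod)
    finally show ?thesis .
  qed
  \<comment> \<open>The product with all coefficients 0 is the constant 1.\<close>
  then have "cmod (canprod (\<lambda>j. 0) w) \<le> cmod (canprod k w)"
    by (intro norm_canprod_le assms) auto
  then show ?thesis by (simp add: canprod_def)
qed

section \<open>Maximum modulus and Phragmen-Lindelof bounds\<close>

text \<open>Since \<open>closure S \<subseteq> T\<close>, the frontier of the open set
  \<open>S\<close> lies in \<open>T - S\<close>. For regions given by inequalities this difference
  is immediate, while the frontier would have to be computed.\<close>

lemma maximum_modulus_subset:
  assumes S: "open S" "bounded S" "S \<subseteq> T" and T: "closed T"
    and hol: "f holomorphic_on T"
    and le: "\<And>z. z \<in> T - S \<Longrightarrow> cmod (f z) \<le> B"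
    and w: "w \<in> T"
  shows "cmod (f w) \<le> B"
proof (cases "w \<in> S")
  case True
  have cl: "closure S \<subseteq> T"
    using S T by (simp add: closure_minimal)
  show ?thesis
  proof (rule maximum_modulus_frontier[where f = f and S = S])
    show "f holomorphic_on interior S"
      using S by (intro holomorphic_on_subset[OF hol]) (simp add: interior_open)
    show "continuous_on (closure S) f"
      using hol cl holomorphic_on_imp_continuous_on holomorphic_on_subset by blast
    show "cmod (f z) \<le> B" if "z \<in> frontier S" for z
      using that cl S(1) by (intro le) (auto simp: frontier_def interior_open)
  qed (use S True in auto)
qed (use le w in auto)

text \<open>
  In a quadrant, \<open>exp (- \<delta> (1 - \<i> s) w)\<close> has modulus at most \<open>exp (- \<delta> \<bar>w\<bar>)\<close>, so exponential type 0
  can be damped without the fractional powers of the usual proof.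
\<close>

lemma phragmen_lindelof_quadrant:
  fixes f :: "complex \<Rightarrow> complex" and s :: real
  assumes s: "\<bar>s\<bar> = 1"
    and hol: "f holomorphic_on {w. Re w \<ge> 0}"
    and growth: "\<And>\<epsilon>. \<epsilon> > 0 \<Longrightarrow> \<exists>C. \<forall>w. Re w \<ge> 0 \<longrightarrow> cmod (f w) \<le> C * exp (\<epsilon> * cmod w)"
    and bdry: "\<And>w. Re w \<ge> 0 \<Longrightarrow> Re w = 0 \<or> Im w = 0 \<Longrightarrow> cmod (f w) \<le> B"
    and w: "Re w \<ge> 0" "s * Im w \<ge> 0"
  shows "cmod (f w) \<le> B"
proof -
  have "cmod (f 0) \<le> B" by (rule bdry) auto
  then have B: "B \<ge> 0" using norm_ge_zero order_trans by blast
  have damped: "cmod (f w) \<le> (B + \<delta>) * exp (\<delta> * (Re w + s * Im w))" if \<delta>: "\<delta> > 0" for \<delta>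
  proof -
    define e where "e z = exp (- of_real \<delta> * (1 - \<i> * of_real s) * z)" for z
    have e: "cmod (e z) = exp (- \<delta> * (Re z + s * Im z))" for z
      by (simp add: e_def algebra_simps)
    \<comment> \<open>Growth at half the damping rate leaves the net factor
      \<open>exp (- (\<delta>/2 * R))\<close> on the arc of radius \<open>R\<close>.\<close>
    obtain C where C: "\<And>z. Re z \<ge> 0 \<Longrightarrow> cmod (f z) \<le> C * exp (\<delta>/2 * cmod z)"
      using growth[of "\<delta>/2"] \<delta> by auto
    have "((\<lambda>R. C * exp (- (\<delta>/2 * R))) \<longlongrightarrow> 0) at_top"
      using \<delta> by real_asymp
    then have "\<forall>\<^sub>F R in at_top. C * exp (- (\<delta>/2 * R)) < \<delta>"
      using \<delta> by (rule order_tendstoD)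
    then have "\<forall>\<^sub>F R in at_top. C * exp (- (\<delta>/2 * R)) < \<delta> \<and> R \<ge> cmod w"
      using eventually_ge_at_top by (rule eventually_conj)
    then obtain R where R: "C * exp (- (\<delta>/2 * R)) < \<delta>" "R \<ge> cmod w"
      by (auto simp: eventually_at_top_linorder)
    have "cmod (f w * e w) \<le> B + \<delta>"
    proof (rule maximum_modulus_subset[where f = "\<lambda>z. f z * e z"
          and S = "{z. Re z > 0 \<and> s * Im z > 0 \<and> cmod z < R}"
          and T = "{z. Re z \<ge> 0 \<and> s * Im z \<ge> 0 \<and> cmod z \<le> R}"])
      show "open {z. Re z > 0 \<and> s * Im z > 0 \<and> cmod z < R}"
        by (intro open_Collect_conj open_Collect_less continuous_intros)
      show "bounded {z. Re z > 0 \<and> s * Im z > 0 \<and> cmod z < R}"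
        by (rule bounded_subset[OF bounded_ball[of 0 R]]) auto
      show "closed {z. Re z \<ge> 0 \<and> s * Im z \<ge> 0 \<and> cmod z \<le> R}"
        by (intro closed_Collect_conj closed_Collect_le continuous_intros)
      show "(\<lambda>z. f z * e z) holomorphic_on {z. Re z \<ge> 0 \<and> s * Im z \<ge> 0 \<and> cmod z \<le> R}"
        unfolding e_def by (intro holomorphic_intros holomorphic_on_subset[OF hol]) auto
      fix z assume z: "z \<in> {z. Re z \<ge> 0 \<and> s * Im z \<ge> 0 \<and> cmod z \<le> R}
          - {z. Re z > 0 \<and> s * Im z > 0 \<and> cmod z < R}"
      then have z': "Re z \<ge> 0" "s * Im z \<ge> 0" by auto
      \<comment> \<open>On the edges the hypothesis applies and the damping factor has modulus at
        most 1; on the arc the damping beats the growth.\<close>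
      consider "Re z = 0 \<or> Im z = 0" | "cmod z = R"
        using z s by (auto simp: less_le)
      then show "cmod (f z * e z) \<le> B + \<delta>"
      proof cases
        case 1
        then have "cmod (f z) * cmod (e z) \<le> B * 1"
          using bdry[OF z'(1) 1] z' \<delta> B by (intro mult_mono) (auto simp: e)
        then show ?thesis using \<delta> by (simp add: norm_mult)
      next
        case 2
        have "s * Im z = \<bar>Im z\<bar>"
          using z' s by (metis abs_mult abs_of_nonneg mult_1)
        then have "cmod z \<le> Re z + s * Im z"
          using cmod_le[of z] z' by simp
        then have "cmod (e z) \<le> exp (- (\<delta> * cmod z))"
          using \<delta> by (simp add: e)
        then have "cmod (f z * e z) \<le> C * exp (\<delta>/2 * cmod z) * exp (- (\<delta> * cmod z))"
          unfolding norm_mult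
          by (intro mult_mono C z' order_trans[OF norm_ge_zero C[OF z'(1)]] norm_ge_zero)
        also have "\<dots> = C * exp (- (\<delta>/2 * R))"
          by (simp add: 2 mult.assoc exp_add[symmetric])
        finally show ?thesis using R B by simp
      qed
    qed (use w R in auto)
    then have "cmod (f w) * exp (- (\<delta> * (Re w + s * Im w))) \<le> B + \<delta>"
      by (simp add: norm_mult e)
    then show ?thesis
      by (simp only: exp_minus divide_inverse[symmetric] pos_divide_le_eq[OF exp_gt_zero])
  qed
  \<comment> \<open>The point \<open>w\<close> is fixed, so the damping is removed by letting
    \<delta> tend to 0 from the right.\<close>
  have "((\<lambda>\<delta>. (B + \<delta>) * exp (\<delta> * (Re w + s * Im w)))
      \<longlongrightarrow> (B + 0) * exp (0 * (Re w + s * Im w))) (at_right 0)"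
    by (intro tendsto_intros)
  then have "((\<lambda>\<delta>. (B + \<delta>) * exp (\<delta> * (Re w + s * Im w))) \<longlongrightarrow> B) (at_right 0)" by simp
  then show ?thesis
    by (rule tendsto_lowerbound) (auto intro!: eventually_at_rightI[of 0 1] damped)
qed

text \<open>The imaginary axis and the positive real axis bound both quadrants, so the sign of
  \<open>Im w\<close> selects the one to use.\<close>

lemma phragmen_lindelof_right_half_plane:
  assumes "f holomorphic_on {w. Re w \<ge> 0}"
    and "\<And>\<epsilon>. \<epsilon> > 0 \<Longrightarrow> \<exists>C. \<forall>w. Re w \<ge> 0 \<longrightarrow> cmod (f w) \<le> C * exp (\<epsilon> * cmod w)"
    and "\<And>w. Re w \<ge> 0 \<Longrightarrow> Re w = 0 \<or> Im w = 0 \<Longrightarrow> cmod (f w) \<le> B"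
    and "Re w \<ge> 0"
  shows "cmod (f w) \<le> B"
proof (cases "Im w \<ge> 0")
  case True
  then show ?thesis
    using phragmen_lindelof_quadrant[of 1 f B w] assms by simp
next
  case False
  then show ?thesis
    using phragmen_lindelof_quadrant[of "-1" f B w] assms by simp
qed

section \<open>Removing zeros by Blaschke factors\<close>

text \<open>Dividing numerator and denominator by \<open>z\<close> exhibits the limit -1 of the
  quotient, which has modulus 1.\<close>

lemma blaschke_factor_tendsto:
  assumes "k \<noteq> (0::real)"
  shows "((\<lambda>z::complex. cmod ((1 + of_real k * z) / (1 - of_real k * z))) \<longlongrightarrow> 1) at_infinity"
proof -
  have "((\<lambda>z::complex. cmod ((inverse z + of_real k) / (inverse z - of_real k)))
      \<longlongrightarrow> cmod ((0 + of_real k) / (0 - of_real k))) at_infinity"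
    using assms by (intro tendsto_intros tendsto_inverse_0) auto
  then have lim: "((\<lambda>z::complex. cmod ((inverse z + of_real k) / (inverse z - of_real k)))
      \<longlongrightarrow> 1) at_infinity"
    using assms by (simp add: norm_divide)
  have "\<forall>\<^sub>F z in at_infinity. z \<noteq> (0::complex)"
    by (rule eventually_not_equal_at_infinity)
  then have "\<forall>\<^sub>F z in at_infinity. cmod ((inverse z + of_real k) / (inverse z - of_real k))
      = cmod ((1 + of_real k * z) / (1 - of_real k * z))"
  proof eventually_elim
    case (elim z)
    have "1 + of_real k * z = z * (inverse z + of_real k)" "1 - of_real k * z = z * (inverse z - of_real k)"
      using elim by (simp_all add: algebra_simps)
    then show ?case using elim by simp
  qed
  with lim show ?thesis by (rule Lim_transform_eventually)
qed

text \<open>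
  \<open>F / K\<^sup>2\<close> is divided by the Blaschke product of its first \<open>n\<close> zeros, which has modulus 1 on the
  imaginary axis and tends to modulus 1 at infinity; the quotient is \<open>w * f w\<close> over the squared tail
  of the product \<open>K\<close>.
\<close>

lemma divided_half_plane_bound:
  fixes k :: "nat \<Rightarrow> real"
  assumes k: "summable (\<lambda>j. \<bar>k j\<bar>)" "\<And>j. k j > 0"
    and f: "f holomorphic_on UNIV"
    and F: "\<And>w. F w = w * (\<Prod>j<n. 1 - (of_real (k j) * w)\<^sup>2) * f w"
    and le: "\<And>w. Re w \<ge> 0 \<Longrightarrow> cmod (F w) \<le> B * (cmod (canprod k w))\<^sup>2"
    and w: "Re w \<ge> 0"
  shows "cmod (w * f w) \<le> B * (cmod (canprod (\<lambda>j. k (j + n)) w))\<^sup>2"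
proof -
  define t where "t = canprod (\<lambda>j. k (j + n))"
  have kn: "summable (\<lambda>j. \<bar>k (j + n)\<bar>)"
    using summable_ignore_initial_segment[OF k(1), of n] by simp
  have t1: "1 \<le> cmod (t z)" if "Re z \<ge> 0" for z
    unfolding t_def using that k kn by (intro one_le_norm_canprod) (auto intro: less_imp_le)
  \<comment> \<open>Evaluation at 1, where the canonical product has modulus at least 1, forces
    \<open>B\<close> to be nonnegative.\<close>
  have "cmod (F 1) \<le> B * (cmod (canprod k 1))\<^sup>2" by (rule le) simp
  then have B: "B \<ge> 0"
    using one_le_norm_canprod[OF k(1), of 1] k(2) norm_ge_zero[of "F 1"]
    by (smt (verit) less_imp_le one_complex.simps(1) mult_neg_pos zero_less_power)
  define G where "G z = z * f z / (t z)\<^sup>2" for z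
  define \<rho> where "\<rho> z = (\<Prod>j<n. cmod ((1 + of_real (k j) * z) / (1 - of_real (k j) * z)))" for z
  \<comment> \<open>With p and q the products of the first \<open>n\<close> factors 1 + k z and 1 -
    k z, F = z p q f and K = p t, so G = (F / K^2) (p / q). At a zero of q the convention x / 0 = 0
    makes \<open>\<rho> z\<close> equal to 0, hence the condition \<open>nz\<close>.\<close>
  have G_le: "cmod (G z) \<le> B * \<rho> z"
    if z: "Re z \<ge> 0" and nz: "\<And>j. j < n \<Longrightarrow> 1 - of_real (k j) * z \<noteq> 0" for z
  proof -
    define p q where "p = (\<Prod>j<n. 1 + of_real (k j) * z)" and "q = (\<Prod>j<n. 1 - of_real (k j) * z)"
    have q: "q \<noteq> 0" using nz by (simp add: q_def)
    have p: "p \<noteq> 0"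
    proof -
      have "1 + of_real (k j) * z \<noteq> 0" for j
      proof
        assume "1 + of_real (k j) * z = 0"
        then have "1 + k j * Re z = 0" by (simp add: complex_eq_iff)
        with k(2)[of j] z show False by (smt (verit) mult_nonneg_nonneg)
      qed
      then show ?thesis by (simp add: p_def)
    qed
    have "F z = z * (p * q) * f z"
      unfolding F p_def q_def prod.distrib[symmetric] by (simp add: power2_eq_square algebra_simps)
    moreover have "canprod k z = p * t z"
      unfolding p_def t_def by (rule canprod_split[OF k(1)])
    ultimately have "cmod (z * f z) * (cmod p * cmod q) \<le> B * (cmod (t z))\<^sup>2 * (cmod p)\<^sup>2"
      using le[OF z] by (simp add: norm_mult power_mult_distrib mult_ac)
    then have "cmod (z * f z) * cmod q \<le> B * (cmod (t z))\<^sup>2 * cmod p"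
      using p by (simp add: power2_eq_square field_simps)
    moreover have "(cmod (t z))\<^sup>2 > 0"
      using t1[OF z] by (intro zero_less_power) linarith
    ultimately have "cmod (z * f z) / (cmod (t z))\<^sup>2 \<le> B * (cmod p / cmod q)"
      using q by (simp add: pos_divide_le_eq pos_le_divide_eq mult_ac)
    moreover have "\<rho> z = cmod p / cmod q"
      unfolding \<rho>_def p_def q_def prod_norm by (simp add: prod_dividef norm_divide)
    ultimately show ?thesis
      by (simp add: G_def norm_divide norm_power)
  qed
  have "((\<lambda>z. B * \<rho> z) \<longlongrightarrow> B * (\<Prod>j<n. 1)) at_infinity"
    unfolding \<rho>_def using k(2) by (intro tendsto_intros blaschke_factor_tendsto) (simp add: less_imp_neq[symmetric])
  then have lim: "((\<lambda>z. B * \<rho> z) \<longlongrightarrow> B) at_infinity" by simp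
  have "cmod (G w) \<le> B + \<eta>" if \<eta>: "\<eta> > 0" for \<eta>
  proof -
    have "\<forall>\<^sub>F z in at_infinity. B * \<rho> z < B + \<eta>"
      using lim by (rule order_tendstoD) (use \<eta> in simp)
    \<comment> \<open>A large arc avoids the finitely many zeros of the denominators, so
      \<open>G_le\<close> applies there. Inside, \<open>G\<close> is holomorphic and the zeros need
      no care.\<close>
    moreover have "\<forall>\<^sub>F z in at_infinity. \<forall>j\<in>{..<n}. z \<noteq> 1 / of_real (k j)"
      by (intro eventually_ball_finite ballI eventually_not_equal_at_infinity) auto
    ultimately have "\<forall>\<^sub>F z in at_infinity. B * \<rho> z < B + \<eta> \<and> (\<forall>j<n. z \<noteq> 1 / of_real (k j))"
      by eventually_elim auto
    then obtain R0 where R0: "\<And>z. cmod z \<ge> R0 \<Longrightarrow> B * \<rho> z < B + \<eta> \<and> (\<forall>j<n. z \<noteq> 1 / of_real (k j))"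
      by (auto simp: eventually_at_infinity)
    define R where "R = max R0 (cmod w)"
    show ?thesis
    proof (rule maximum_modulus_subset[where f = G and S = "{z. Re z > 0 \<and> cmod z < R}"
          and T = "{z. Re z \<ge> 0 \<and> cmod z \<le> R}"])
      show "open {z. Re z > 0 \<and> cmod z < R}"
        by (intro open_Collect_conj open_Collect_less continuous_intros)
      show "bounded {z. Re z > 0 \<and> cmod z < R}"
        by (rule bounded_subset[OF bounded_ball[of 0 R]]) auto
      show "closed {z. Re z \<ge> 0 \<and> cmod z \<le> R}"
        by (intro closed_Collect_conj closed_Collect_le continuous_intros)
      have "t z \<noteq> 0" if "Re z \<ge> 0" for z using t1[OF that] by auto
      moreover have "t holomorphic_on A" for A
        unfolding t_def using kn by (rule holomorphic_canprod)
      ultimately show "G holomorphic_on {z. Re z \<ge> 0 \<and> cmod z \<le> R}"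
        unfolding G_def by (intro holomorphic_intros holomorphic_on_subset[OF f]) auto
      fix z assume z: "z \<in> {z. Re z \<ge> 0 \<and> cmod z \<le> R} - {z. Re z > 0 \<and> cmod z < R}"
      then consider "Re z = 0" | "cmod z = R" "Re z \<ge> 0" by fastforce
      then show "cmod (G z) \<le> B + \<eta>"
      proof cases
        case 1
        \<comment> \<open>For purely imaginary \<open>z\<close> the two factors are complex
          conjugates.\<close>
        have "cmod (1 + of_real (k j) * z) = cmod (1 - of_real (k j) * z)"
          and nz: "1 - of_real (k j) * z \<noteq> 0" for j
          using 1 by (auto simp: cmod_def complex_eq_iff)
        then have "\<rho> z = 1"
          unfolding \<rho>_def by (intro prod.neutral) (simp add: norm_divide)
        with G_le[of z] 1 nz \<eta> show ?thesis by simp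
      next
        case 2
        then have "R0 \<le> cmod z" by (simp add: R_def)
        from R0[OF this] have "cmod (G z) \<le> B * \<rho> z"
          using 2 k(2) by (intro G_le) (auto simp: field_simps less_imp_neq[symmetric])
        with R0[OF \<open>R0 \<le> cmod z\<close>] show ?thesis by linarith
      qed
    qed (use w in \<open>auto simp: R_def\<close>)
  qed
  then have "cmod (G w) \<le> B"
    by (rule field_le_epsilon)
  then have "cmod (w * f w) / (cmod (t w))\<^sup>2 \<le> B"
    by (simp add: G_def norm_divide norm_power)
  moreover have "(cmod (t w))\<^sup>2 > 0"
    using t1[OF w] by (intro zero_less_power) linarith
  ultimately show ?thesis
    unfolding t_def[symmetric] by (simp add: pos_divide_le_eq)
qed

section \<open>Odd entire functions with prescribed zeros\<close>

text \<open>The difference quotient has a removable singularity at \<open>a\<close>, filled by the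
  derivative.\<close>

lemma entire_factor_zero:
  assumes "f holomorphic_on UNIV" "f a = 0"
  obtains h where "h holomorphic_on UNIV" "\<And>w. f w = (w - a) * h w"
proof
  show "(\<lambda>w. if w = a then deriv f a else (f w - f a) / (w - a)) holomorphic_on UNIV"
    using assms by (intro pole_lemma_open) auto
qed (use assms in auto)

text \<open>Oddness gives the zero at 0 and makes the zeros symmetric. Each induction step divides
  out one pair \<open>a\<close>, \<open>- a\<close> by two difference quotients.\<close>

lemma odd_entire_factor:
  fixes k :: "nat \<Rightarrow> real"
  assumes k: "\<And>j. k j > 0" "inj k"
    and F: "F holomorphic_on UNIV" "\<And>w. F (- w) = - F w" "\<And>j. F (1 / of_real (k j)) = 0"
  shows "\<exists>f. f holomorphic_on UNIV \<and> (\<forall>w. F w = w * (\<Prod>j<n. 1 - (of_real (k j) * w)\<^sup>2) * f w)"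
proof (induction n)
  case 0
  have "F 0 = 0" using F(2)[of 0] by simp
  then obtain h where "h holomorphic_on UNIV" "\<And>w. F w = (w - 0) * h w"
    using entire_factor_zero[OF F(1)] by blast
  then show ?case by auto
next
  case (Suc n)
  then obtain f where f: "f holomorphic_on UNIV"
    "\<And>w. F w = w * (\<Prod>j<n. 1 - (of_real (k j) * w)\<^sup>2) * f w" by blast
  define a :: complex where "a = 1 / of_real (k n)"
  have kn: "complex_of_real (k n) \<noteq> 0" using k(1)[of n] by simp
  \<comment> \<open>Distinctness of the positive \<open>k j\<close> keeps the earlier factors
    nonzero at the new pair, so it is the cofactor \<open>f\<close> that vanishes there.\<close>
  have nz: "1 - (of_real (k j) * w)\<^sup>2 \<noteq> 0" if "j < n" "w = a \<or> w = - a" for j w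
  proof
    assume "1 - (of_real (k j) * w)\<^sup>2 = 0"
    moreover have "(of_real (k n) * w)\<^sup>2 = 1"
      using that(2) kn by (auto simp: a_def)
    ultimately have "(of_real (k j))\<^sup>2 = (of_real (k n) :: complex)\<^sup>2"
      by algebra
    then have "(k j)\<^sup>2 = (k n)\<^sup>2"
      by (metis of_real_eq_iff of_real_power)
    then have "k j = k n"
      using k(1)[of j] k(1)[of n] by (auto simp: power2_eq_iff)
    with k(2) \<open>j < n\<close> show False by (auto dest: injD)
  qed
  have "F a = 0" "F (- a) = 0" using F by (auto simp: a_def)
  moreover have "a \<noteq> 0" using kn by (simp add: a_def)
  ultimately have fa: "f a = 0" "f (- a) = 0"
    using f(2)[of a] f(2)[of "- a"] nz by auto
  obtain g where g: "g holomorphic_on UNIV" "\<And>w. f w = (w - a) * g w"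
    using entire_factor_zero[OF f(1) fa(1)] by blast
  have "g (- a) = 0"
    using fa(2) \<open>a \<noteq> 0\<close> g(2)[of "- a"] by simp
  then obtain h where h: "h holomorphic_on UNIV" "\<And>w. g w = (w - - a) * h w"
    using entire_factor_zero[OF g(1)] by blast
  \<comment> \<open>This gives (w - a)(w + a) = - a^2 (1 - (k w)^2) with k = \<open>k n\<close>, the
    normalisation of the factors in the product.\<close>
  have "of_real (k n) * a = 1" using kn by (simp add: a_def)
  then have "f w = (1 - (of_real (k n) * w)\<^sup>2) * (- a\<^sup>2 * h w)" for w
    unfolding g(2) h(2) by algebra
  then have "F w = w * (\<Prod>j<Suc n. 1 - (of_real (k j) * w)\<^sup>2) * (- a\<^sup>2 * h w)" for w
    using f(2)[of w] by (simp add: mult_ac)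
  moreover have "(\<lambda>w. - a\<^sup>2 * h w) holomorphic_on UNIV"
    by (intro holomorphic_intros h)
  ultimately show ?case by blast
qed

text \<open>A Liouville argument at a fixed point: \<open>cmod (F w)\<close> is bounded by a
  constant over \<open>R\<close> for every large \<open>R\<close>.\<close>

lemma odd_entire_eq_0:
  fixes k :: "nat \<Rightarrow> real"
  assumes k: "summable (\<lambda>j. \<bar>k j\<bar>)" "\<And>j. k j > 0" "inj k"
    and F: "F holomorphic_on UNIV" "\<And>w. F (- w) = - F w" "\<And>j. F (1 / of_real (k j)) = 0"
    and le: "\<And>w. Re w \<ge> 0 \<Longrightarrow> cmod (F w) \<le> B * (cmod (canprod k w))\<^sup>2"
  shows "F w = 0"
proof -
  \<comment> \<open>The factors bound, in turn, the extra \<open>w\<close>, the product of divided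
    zeros uniformly in \<open>n\<close>, and \<open>R\<close> times the cofactor on the circle. None
    depends on \<open>R\<close>.\<close>
  define D where "D = cmod w * exp (cmod w * (\<Sum>j. \<bar>k j\<bar>)) ^ 2 * (B * exp 1 ^ 2)"
  have "cmod (F w) \<le> D / R" if R: "R > cmod w" for R
  proof -
    have R0: "R > 0" using R norm_ge_zero[of w] by linarith
    \<comment> \<open>Enough zeros are divided out to make the tail of the product bounded on the circle of radius \<open>R\<close>;
      the extra factor \<open>w\<close> then supplies the decay \<open>1 / R\<close>.\<close>
    obtain n where n: "(\<Sum>j. \<bar>k (j + n)\<bar>) < 1 / R"
      using summable_tail_small[OF k(1), of "1 / R"] R0 by auto
    obtain f where f: "f holomorphic_on UNIV"
      and Ff: "\<And>w. F w = w * (\<Prod>j<n. 1 - (of_real (k j) * w)\<^sup>2) * f w"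
      using odd_entire_factor[OF k(2,3) F] by blast
    have kn: "summable (\<lambda>j. \<bar>k (j + n)\<bar>)"
      using summable_ignore_initial_segment[OF k(1), of n] by simp
    have t_le: "cmod (canprod (\<lambda>j. k (j + n)) z) \<le> exp 1" if "cmod z = R" for z
    proof -
      have "cmod (canprod (\<lambda>j. k (j + n)) z) \<le> exp (R * (\<Sum>j. \<bar>k (j + n)\<bar>))"
        using norm_canprod_le_exp[OF kn, of z] that by simp
      also have "\<dots> \<le> exp 1"
        using n R0 by (simp add: field_simps)
      finally show ?thesis .
    qed
    have "cmod (F 1) \<le> B * (cmod (canprod k 1))\<^sup>2" by (rule le) simp
    then have B: "B \<ge> 0"
      using one_le_norm_canprod[OF k(1), of 1] k(2) norm_ge_zero[of "F 1"]
      by (smt (verit) less_imp_le one_complex.simps(1) mult_neg_pos zero_less_power)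
    \<comment> \<open>Stated for an arbitrary cofactor \<open>h\<close>, since the left half of the
      circle is covered by the reflected cofactor \<open>f (- z)\<close>, which also factors
      \<open>F\<close>.\<close>
    have circ: "cmod (h z) \<le> B * exp 1 ^ 2 / R"
      if h: "h holomorphic_on UNIV" "\<And>w. F w = w * (\<Prod>j<n. 1 - (of_real (k j) * w)\<^sup>2) * h w"
        and z: "Re z \<ge> 0" "cmod z = R" for h z
    proof -
      have "cmod (z * h z) \<le> B * (cmod (canprod (\<lambda>j. k (j + n)) z))\<^sup>2"
        by (rule divided_half_plane_bound[OF k(1,2) h le z(1)])
      also have "\<dots> \<le> B * exp 1 ^ 2"
        using B t_le[OF z(2)] by (intro mult_left_mono power_mono) auto
      finally show ?thesis
        using R0 z(2) by (simp add: norm_mult pos_le_divide_eq mult.commute)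
    qed
    have f_le: "cmod (f w) \<le> B * exp 1 ^ 2 / R"
    proof (rule maximum_modulus_subset[where f = f and S = "ball 0 R" and T = "cball 0 R"])
      fix z :: complex assume "z \<in> cball 0 R - ball 0 R"
      then have z: "cmod z = R" by auto
      show "cmod (f z) \<le> B * exp 1 ^ 2 / R"
      proof (cases "Re z \<ge> 0")
        case True
        with f Ff z show ?thesis by (intro circ)
      next
        case False
        have "(\<lambda>z. f (- z)) holomorphic_on UNIV"
          using holomorphic_on_compose[OF _ holomorphic_on_subset[OF f], of uminus UNIV]
          by (simp add: o_def holomorphic_on_minus)
        moreover have "F v = v * (\<Prod>j<n. 1 - (of_real (k j) * v)\<^sup>2) * f (- v)" for v
          using Ff[of "- v"] F(2)[of v] by simp
        ultimately have "cmod (f (- (- z))) \<le> B * exp 1 ^ 2 / R"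
          using False z by (intro circ) auto
        then show ?thesis by simp
      qed
    qed (use R holomorphic_on_subset[OF f] in auto)
    have "(\<Prod>j<n. 1 + cmod w * \<bar>k j\<bar>) \<le> exp (\<Sum>j<n. cmod w * \<bar>k j\<bar>)"
      by (rule prod_le_exp_sum) auto
    also have "\<dots> \<le> exp (cmod w * (\<Sum>j. \<bar>k j\<bar>))"
      unfolding sum_distrib_left[symmetric] exp_le_cancel_iff
      by (intro mult_left_mono sum_le_suminf k) auto
    finally have prod_le: "(\<Prod>j<n. 1 + cmod w * \<bar>k j\<bar>) \<le> exp (cmod w * (\<Sum>j. \<bar>k j\<bar>))" .
    have "cmod (1 - (of_real (k j) * w)\<^sup>2) \<le> (1 + cmod w * \<bar>k j\<bar>)\<^sup>2" for j
    proof -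
      have "cmod (1 - (of_real (k j) * w)\<^sup>2) \<le> 1 + (cmod w * \<bar>k j\<bar>)\<^sup>2"
        using norm_triangle_ineq4[of 1 "(of_real (k j) * w)\<^sup>2"]
        by (simp add: norm_mult norm_power mult.commute)
      also have "\<dots> \<le> (1 + cmod w * \<bar>k j\<bar>)\<^sup>2"
        by (simp add: power2_sum)
      finally show ?thesis .
    qed
    then have "cmod (\<Prod>j<n. 1 - (of_real (k j) * w)\<^sup>2) \<le> (\<Prod>j<n. (1 + cmod w * \<bar>k j\<bar>)\<^sup>2)"
      unfolding prod_norm[symmetric] by (intro prod_mono) auto
    also have "\<dots> = (\<Prod>j<n. 1 + cmod w * \<bar>k j\<bar>)\<^sup>2"
      by (simp add: prod_power_distrib)
    also have "\<dots> \<le> exp (cmod w * (\<Sum>j. \<bar>k j\<bar>)) ^ 2"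
      by (intro power_mono prod_le prod_nonneg) auto
    finally have "cmod (\<Prod>j<n. 1 - (of_real (k j) * w)\<^sup>2) \<le> exp (cmod w * (\<Sum>j. \<bar>k j\<bar>)) ^ 2" .
    then have "cmod (F w) \<le> cmod w * exp (cmod w * (\<Sum>j. \<bar>k j\<bar>)) ^ 2 * (B * exp 1 ^ 2 / R)"
      unfolding Ff norm_mult using f_le by (intro mult_mono) auto
    then show ?thesis by (simp add: D_def)
  qed
  then have "\<forall>\<^sub>F R in at_top. cmod (F w) \<le> D / R"
    by (rule eventually_mono[OF eventually_gt_at_top])
  moreover have "((\<lambda>R. D / R) \<longlongrightarrow> 0) at_top"
    by real_asymp
  ultimately have "cmod (F w) \<le> 0"
    by (intro tendsto_lowerbound[where f = "\<lambda>R. D / R"]) auto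
  then show ?thesis by simp
qed

section \<open>Values of \<open>g\<close> and interlacing\<close>

text \<open>Each factor is divided through by \<open>z\<close>; summability makes the numerators and
  the denominators converge separately.\<close>

lemma g_eq_canprod:
  assumes l: "summable (\<lambda>j. \<bar>l j\<bar>)" and "z \<noteq> 0"
  shows "g l z = canprod l (- 1 / z) / canprod l (1 / z)"
proof -
  have "summable (\<lambda>j. \<bar>- l j\<bar>)" using l by simp
  note conv = convergent_canprod[OF this, of "1 / z"] convergent_canprod[OF l, of "1 / z"]
  have "(\<lambda>j. (z - of_real (l j)) / (z + of_real (l j)))
      = (\<lambda>j. (1 + of_real (- l j) * (1 / z)) / (1 + of_real (l j) * (1 / z)))"
  proof
    fix j
    have "z - of_real (l j) = z * (1 + of_real (- l j) * (1 / z))"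
      "z + of_real (l j) = z * (1 + of_real (l j) * (1 / z))"
      using \<open>z \<noteq> 0\<close> by (simp_all add: field_simps)
    then show "(z - of_real (l j)) / (z + of_real (l j))
        = (1 + of_real (- l j) * (1 / z)) / (1 + of_real (l j) * (1 / z))"
      using \<open>z \<noteq> 0\<close> by (metis mult_divide_mult_cancel_left)
  qed
  then have "g l z = canprod (\<lambda>j. - l j) (1 / z) / canprod l (1 / z)"
    unfolding g_def canprod_def using prodinf_divide[OF conv] by simp
  then show ?thesis by (simp add: canprod_uminus)
qed

lemma LambdaD:
  assumes "l \<in> Lambda \<kappa>"
  shows "\<bar>l j\<bar> < \<kappa> j" "\<kappa> (Suc j) < \<bar>l j\<bar>"
  using assms by (auto simp: Lambda_def)

lemma summable_Lambda:
  assumes "summable (\<lambda>j. \<bar>\<kappa> j\<bar>)" "l \<in> Lambda \<kappa>"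
  shows "summable (\<lambda>j. \<bar>l j\<bar>)"
proof (rule summable_comparison_test'[OF assms(1)])
  show "norm \<bar>l j\<bar> \<le> \<bar>\<kappa> j\<bar>" for j
    using LambdaD(1)[OF assms(2), of j] by simp
qed

text \<open>The moduli with index \<open>i\<close> lie in the open interval from
  \<open>\<kappa> (Suc i)\<close> to \<open>\<kappa> i\<close>, and these intervals are
  disjoint.\<close>

lemma Lambda_abs_eq_imp_eq:
  assumes \<kappa>: "decseq \<kappa>" and l: "l \<in> Lambda \<kappa>" "l' \<in> Lambda \<kappa>" and eq: "\<bar>l i\<bar> = \<bar>l' j\<bar>"
  shows "i = j"
proof (rule ccontr)
  assume "i \<noteq> j"
  then consider "Suc i \<le> j" | "Suc j \<le> i" by linarith
  then show False
  proof cases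
    case 1
    with decseqD[OF \<kappa> 1] LambdaD[OF l(1), of i] LambdaD[OF l(2), of j] eq show False by linarith
  next
    case 2
    with decseqD[OF \<kappa> 2] LambdaD[OF l(1), of i] LambdaD[OF l(2), of j] eq show False by linarith
  qed
qed

theorem theorem5p7:
  fixes \<kappa> l l' :: "nat \<Rightarrow> real"
  assumes "summable (\<lambda>j. \<bar>\<kappa> j\<bar>)"
    and "\<And>j. \<kappa> j > \<kappa> (Suc j) \<and> \<kappa> (Suc j) > 0"
    and "l \<in> Lambda \<kappa>"
    and "l' \<in> Lambda \<kappa>"
    and "\<And>j. g l (complex_of_real (\<kappa> j)) = g l' (complex_of_real (\<kappa> j))"
  shows "l = l'"
proof -
  have pos: "\<kappa> j > 0" for j
    using assms(2)[of j] by linarith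
  have "strict_mono (\<lambda>j. - \<kappa> j)"
    using assms(2) by (intro strict_monoI_Suc) simp
  then have inj: "inj \<kappa>"
    using strict_mono_imp_inj_on[of "\<lambda>j. - \<kappa> j"] by (auto simp: inj_on_def)
  have dec: "decseq \<kappa>"
    using assms(2) by (intro decseq_SucI) (simp add: less_imp_le)
  have sum: "summable (\<lambda>j. \<bar>l j\<bar>)" "summable (\<lambda>j. \<bar>l' j\<bar>)"
    using assms(1,3,4) summable_Lambda by blast+
  \<comment> \<open>A zero here would need \<open>\<bar>a i\<bar> = \<kappa> j\<close>, against
    strict interlacing. The denominators of \<open>g\<close> are therefore nonzero at these points,
    and equal values may be cross-multiplied.\<close>
  have at_\<kappa>: "canprod a (1 / of_real (\<kappa> j)) \<noteq> 0" if a: "a \<in> Lambda \<kappa>" for a j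
  proof
    assume "canprod a (1 / of_real (\<kappa> j)) = 0"
    then obtain i where "1 + of_real (a i) * (1 / of_real (\<kappa> j) :: complex) = 0"
      using canprod_eq_0_iff[OF summable_Lambda[OF assms(1) a]] by blast
    then have "complex_of_real (\<kappa> j + a i) = 0"
      using pos[of j] by (simp add: field_simps)
    then have "\<kappa> j + a i = 0"
      by (simp only: of_real_eq_0_iff)
    then have *: "\<bar>a i\<bar> = \<kappa> j" using pos[of j] by linarith
    show False
    proof (cases "j \<le> i")
      case True
      with decseqD[OF dec True] LambdaD(1)[OF a, of i] * show False by linarith
    next
      case False
      then have "Suc i \<le> j" by simp
      with decseqD[OF dec this] LambdaD(2)[OF a, of i] * show False by linarith
    qed
  qed
  \<comment> \<open>The numerator of the difference of the two functions at 1/w;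
    \<open>canprod l (- w)\<close> is the product of the factors 1 - l_j w.\<close>
  define F where "F w = canprod l (- w) * canprod l' w - canprod l w * canprod l' (- w)" for w
  have hol: "F holomorphic_on A" for A
    unfolding F_def using sum by (intro holomorphic_intros)
  have F0: "F (1 / of_real (\<kappa> j)) = 0" for j
    using assms(5)[of j] pos[of j] at_\<kappa>[OF assms(3), of j] at_\<kappa>[OF assms(4), of j]
    by (simp add: F_def g_eq_canprod sum field_simps)
  have K1: "1 \<le> cmod (canprod \<kappa> w)" if "Re w \<ge> 0" for w
    using that assms(1) pos by (intro one_le_norm_canprod) (auto intro: less_imp_le)
  have F_le: "cmod (F w) \<le> 2 * (cmod (canprod \<kappa> w))\<^sup>2" if w: "Re w \<ge> 0" for w
  proof -
    have "cmod (F w / (canprod \<kappa> w)\<^sup>2) \<le> 2"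
    proof (rule phragmen_lindelof_right_half_plane[where f = "\<lambda>w. F w / (canprod \<kappa> w)\<^sup>2"])
      have "canprod \<kappa> w \<noteq> 0" if "Re w \<ge> 0" for w using K1[OF that] by auto
      then show "(\<lambda>w. F w / (canprod \<kappa> w)\<^sup>2) holomorphic_on {w. Re w \<ge> 0}"
        using assms(1) by (intro holomorphic_intros hol) auto
    next
      fix \<epsilon> :: real assume "\<epsilon> > 0"
      then have "\<epsilon> / 2 > 0" by simp
      obtain C where C: "C > 0" "\<And>w. cmod (canprod l w) \<le> C * exp (\<epsilon>/2 * cmod w)"
        using canprod_minimal_type[OF sum(1) \<open>\<epsilon> / 2 > 0\<close>] by blast
      obtain C' where C': "C' > 0" "\<And>w. cmod (canprod l' w) \<le> C' * exp (\<epsilon>/2 * cmod w)"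
        using canprod_minimal_type[OF sum(2) \<open>\<epsilon> / 2 > 0\<close>] by blast
      have "cmod (F w / (canprod \<kappa> w)\<^sup>2) \<le> 2 * C * C' * exp (\<epsilon> * cmod w)" if "Re w \<ge> 0" for w
      proof -
        have "cmod (canprod l u) * cmod (canprod l' v) \<le> C * C' * exp (\<epsilon> * cmod w)"
          if "cmod u = cmod w" "cmod v = cmod w" for u v
        proof -
          have "cmod (canprod l u) * cmod (canprod l' v)
              \<le> (C * exp (\<epsilon>/2 * cmod w)) * (C' * exp (\<epsilon>/2 * cmod w))"
            using C C' that by (intro mult_mono) (metis, metis, auto)
          also have "\<dots> = C * C' * (exp (\<epsilon>/2 * cmod w) * exp (\<epsilon>/2 * cmod w))"
            by (simp add: mult_ac)
          also have "exp (\<epsilon>/2 * cmod w) * exp (\<epsilon>/2 * cmod w) = exp (\<epsilon> * cmod w)"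
            by (simp add: exp_add[symmetric] field_simps)
          finally show ?thesis .
        qed
        from this[of "- w" w] this[of w "- w"]
        have "cmod (F w) \<le> 2 * C * C' * exp (\<epsilon> * cmod w)"
          unfolding F_def
          using norm_triangle_ineq4[of "canprod l (- w) * canprod l' w" "canprod l w * canprod l' (- w)"]
          by (simp add: norm_mult)
        moreover have "cmod (F w) / (cmod (canprod \<kappa> w))\<^sup>2 \<le> cmod (F w)"
          using K1[OF that] by (simp add: divide_le_eq mult_le_cancel_left1)
        ultimately show ?thesis by (simp add: norm_divide norm_power)
      qed
      then show "\<exists>C. \<forall>w. Re w \<ge> 0 \<longrightarrow> cmod (F w / (canprod \<kappa> w)\<^sup>2) \<le> C * exp (\<epsilon> * cmod w)"
        by blast
    next
      fix w assume w: "Re w \<ge> 0" "Re w = 0 \<or> Im w = 0"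
      \<comment> \<open>The value at \<open>- w\<close> is the product for the negated sequence,
        which has the same moduli.\<close>
      have le: "cmod (canprod a w) \<le> cmod (canprod \<kappa> w)"
        "cmod (canprod a (- w)) \<le> cmod (canprod \<kappa> w)" if a: "a \<in> Lambda \<kappa>" for a
      proof -
        have a_le: "\<bar>a j\<bar> \<le> \<kappa> j" for j using LambdaD(1)[OF a] by (rule less_imp_le)
        have s: "summable (\<lambda>j. \<bar>a j\<bar>)" "summable (\<lambda>j. \<bar>- a j\<bar>)"
          using summable_Lambda[OF assms(1) a] by simp_all
        show "cmod (canprod a w) \<le> cmod (canprod \<kappa> w)"
          by (intro norm_canprod_le norm_one_plus_mult_le s assms(1) a_le w)
        have "cmod (canprod (\<lambda>j. - a j) w) \<le> cmod (canprod \<kappa> w)"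
          by (intro norm_canprod_le norm_one_plus_mult_le s assms(1) w) (simp add: a_le)
        then show "cmod (canprod a (- w)) \<le> cmod (canprod \<kappa> w)"
          by (simp add: canprod_uminus)
      qed
      have "cmod (F w) \<le> cmod (canprod l (- w)) * cmod (canprod l' w)
          + cmod (canprod l w) * cmod (canprod l' (- w))"
        unfolding F_def norm_mult[symmetric] by (rule norm_triangle_ineq4)
      also have "\<dots> \<le> cmod (canprod \<kappa> w) * cmod (canprod \<kappa> w)
          + cmod (canprod \<kappa> w) * cmod (canprod \<kappa> w)"
        using assms(3,4) by (intro add_mono mult_mono le) auto
      finally have "cmod (F w) \<le> 2 * (cmod (canprod \<kappa> w))\<^sup>2"
        by (simp add: power2_eq_square)
      then show "cmod (F w / (canprod \<kappa> w)\<^sup>2) \<le> 2"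
        using K1[OF w(1)] by (simp add: norm_divide norm_power divide_le_eq)
    qed (rule w)
    moreover have "(cmod (canprod \<kappa> w))\<^sup>2 > 0"
      using K1[OF w] by (intro zero_less_power) linarith
    ultimately show ?thesis
      by (simp add: norm_divide norm_power pos_divide_le_eq)
  qed
  have F_zero: "F w = 0" for w
    using assms(1) pos inj hol _ F0 F_le
    by (rule odd_entire_eq_0) (simp add: F_def)
  show ?thesis
  proof
    fix j
    have lj: "l j \<noteq> 0"
      using LambdaD(2)[OF assms(3), of j] pos[of "Suc j"] by auto
    \<comment> \<open>A zero of \<open>canprod l (- w)\<close>, so the other product in
      \<open>F\<close> must vanish too.\<close>
    define w :: complex where "w = 1 / of_real (l j)"
    have "canprod l (- w) = 0"
      unfolding canprod_eq_0_iff[OF sum(1)] using lj by (intro exI[of _ j]) (simp add: w_def)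
    then have "canprod l w * canprod l' (- w) = 0"
      using F_zero[of w] by (simp add: F_def)
    \<comment> \<open>A common zero would give \<open>l i = - l j\<close>. Equal moduli force
      \<open>i = j\<close>, and then \<open>l j\<close> would be 0.\<close>
    moreover have "canprod l w \<noteq> 0"
    proof
      assume "canprod l w = 0"
      then obtain i where "1 + of_real (l i) * w = 0"
        unfolding canprod_eq_0_iff[OF sum(1)] by blast
      then have "complex_of_real (l j + l i) = 0"
        using lj by (simp add: w_def field_simps)
      then have li: "l j + l i = 0"
        by (simp only: of_real_eq_0_iff)
      then have "\<bar>l j\<bar> = \<bar>l i\<bar>" by linarith
      then have "j = i"
        by (rule Lambda_abs_eq_imp_eq[OF dec assms(3,3)])
      with li lj show False by simp
    qed
    ultimately obtain i where "1 + of_real (l' i) * (- w) = 0"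
      using canprod_eq_0_iff[OF sum(2)] by (auto simp del: mult_minus_right)
    then have "complex_of_real (l j) = of_real (l' i)"
      using lj by (simp add: w_def field_simps)
    then have li: "l j = l' i"
      by (simp only: of_real_eq_iff)
    \<comment> \<open>The value \<open>l j\<close> occurs somewhere in the second sequence;
      interlacing fixes its position.\<close>
    then have "j = i"
      by (intro Lambda_abs_eq_imp_eq[OF dec assms(3,4)]) simp
    with li show "l j = l' j" by simp
  qed
qed

end
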